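(* Let $C$ be a nonempty closed convex subset of a real Hilbert space $H$. Let $T:C\to C$ be a nonexpansive mapping with $F(T)\ne\emptyset$. Suppose $\{\alpha_n\}_{n\ge0}$ and $\{\beta_n\}_{n\ge0}$ are two real sequences in $[0,1]$ satisfying $0<\alpha'\le\alpha_n\le\alpha<1$ (for some constants $\alpha',\alpha$) and $0<\beta_n\le1$ for all $n$. Let $x_0\in C$ be arbitrary and let $\{x_n\}$ be generated, for $n\ge0$, by $$v_n=(1-\alpha_n)x_n+\alpha_nTx_n,\qquad y_n=(1-\beta_n)x_n+\beta_nTv_n,$$ $$C_n=\{z\in C:\|z-y_n\|^2\le\|z-x_n\|^2-\alpha_n\beta_n(1-\alpha_n)\|x_n-Tx_n\|^2\},$$ $$Q_n=\{z\in C:\langle z-x_n,x_n-x_0\rangle\ge0\},$$ $$x_{n+1}=P_{C_n^*\cap Q_n}x_0,$$ where $C_n^*$ is a closed convex set with $F(T)\subset C_n^*\subset C_n$. Then $\{x_n\}$ converges strongly to the fixed point $P_{F(T)}x_0$.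
   Context: $F(T)=\{x\in C:Tx=x\}$. $T$ is nonexpansive if $\|Tx-Ty\|\le\|x-y\|$ for all $x,y\in C$. For a nonempty closed convex set $D\subset H$, $P_D$ is the metric projection (nearest-point map) onto $D$. *)

theory Defs
  imports "HOL-Analysis.Analysis"
begin

text \<open>A real Hilbert space is a type of sort \<open>{real_inner, complete_space}\<close>.\<close>

definition fixed_points :: "'a set \<Rightarrow> ('a \<Rightarrow> 'a) \<Rightarrow> 'a set"
  where "fixed_points C T = {x \<in> C. T x = x}"

definition nonexpansive_on :: "'a::real_normed_vector set \<Rightarrow> ('a \<Rightarrow> 'a) \<Rightarrow> bool"
  where "nonexpansive_on C T \<longleftrightarrow> (\<forall>x\<in>C. \<forall>y\<in>C. norm (T x - T y) \<le> norm (x - y))"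

text \<open>The library's \<open>closest_point\<close> requires the class \<open>heine_borel\<close>, which excludes
  infinite-dimensional spaces. As there, the value is meaningful only if a nearest point exists,
  which for nonempty closed convex \<open>D\<close> in a Hilbert space is always (and uniquely) the case.\<close>

definition metric_projection :: "'a::{real_inner, complete_space} set \<Rightarrow> 'a \<Rightarrow> 'a"
  where "metric_projection D a = (THE p. p \<in> D \<and> (\<forall>z\<in>D. norm (a - p) \<le> norm (a - z)))"

end

theory Submission
  imports Defs
begin

text \<open>
  Write \<open>a\<close> for \<open>x 0\<close>, \<open>F\<close> for the fixed point set and \<open>q\<close> for the projection of \<open>a\<close> onto \<open>F\<close>.
  The argument has two halves.

  The iteration yields a bounded sequence of approximate fixed points. By the variational
  characterization of projections, \<open>Qn n\<close> is the part of \<open>C\<close> lying beyond the hyperplane through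
  \<open>x n\<close> orthogonal to \<open>x n - a\<close>. Inductively \<open>F\<close> stays inside \<open>Cn_star n \<inter> Qn n\<close>, so that the
  projections exist and \<open>norm (x n - a)\<close> is at most the distance from \<open>a\<close> to any fixed point.
  Since \<open>x (Suc n)\<close> lies in \<open>Qn n\<close>, these norms increase, and their squares dominate the squared
  steps; hence the steps tend to \<open>0\<close>. Membership of \<open>x (Suc n)\<close> in \<open>Cn n\<close> bounds the residual
  \<open>norm (x n - T (x n))\<close> by the step length. The factor \<open>\<beta> n\<close>, which may tend to \<open>0\<close>, occurs in the
  definition of \<open>Cn n\<close> and also in \<open>norm (y n - x n) = \<beta> n * norm (x n - T (v n))\<close>, so it cancels.

  The second half, \<open>asymptotically_fixed_converges\<close>, turns small residuals into strong convergence
  to \<open>q\<close>. The classical route takes weak subsequential limits and uses demiclosedness of \<open>I - T\<close>.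
  Here weak convergence is replaced by Browder's resolvent path: the points \<open>z k\<close> with
  \<open>z k - T (z k) = (a - z k) / (k + 1)\<close> converge in norm to \<open>q\<close>, because \<open>I - T\<close> is monotone
  (\<open>resolvents_converge\<close>). Monotonicity between \<open>x n\<close> and \<open>z k\<close> then bounds the inner product of
  \<open>a - z k\<close> and \<open>x n - z k\<close> by a multiple of the residual of \<open>x n\<close>. As \<open>norm (x n - a)\<close> is at most
  \<open>norm (q - a)\<close>, the squared distance from \<open>x n\<close> to \<open>q\<close> is at most twice the inner product of
  \<open>x n - q\<close> and \<open>a - q\<close>, which is close to the one just bounded when \<open>z k\<close> is close to \<open>q\<close>.
\<close>

section \<open>Metric projections\<close>

text \<open>The points of \<open>D\<close> that are nearly nearest to \<open>a\<close> form nested closed sets. By the parallelogram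
  law their diameters shrink to \<open>0\<close>, the midpoint of two such points being in \<open>D\<close> and so no
  nearer to \<open>a\<close> than the infimum. Completeness gives a common point.\<close>

lemma closed_convex_nearest_point:
  fixes D :: "'a::{real_inner, complete_space} set"
  assumes D: "D \<noteq> {}" "closed D" "convex D"
  obtains p where "p \<in> D" "\<And>z. z \<in> D \<Longrightarrow> norm (a - p) \<le> norm (a - z)"
proof -
  define d where "d = infdist a D"
  define \<delta> :: "nat \<Rightarrow> real" where "\<delta> n = inverse (real (Suc n))" for n
  define S where "S n = D \<inter> cball a (d + \<delta> n)" for n
  have d0: "0 \<le> d" by (simp add: d_def infdist_nonneg)
  have dD: "d \<le> norm (a - z)" if "z \<in> D" for z
    using infdist_le[OF that, of a] by (simp add: d_def dist_norm)
  have \<delta>: "0 < \<delta> n" "\<delta> n \<le> 1" for n by (auto simp: \<delta>_def field_simps)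
  have lim: "\<delta> \<longlonglongrightarrow> 0"
    unfolding \<delta>_def by (rule LIMSEQ_inverse_real_of_nat)
  have diam: "(norm (u - w))\<^sup>2 \<le> 4 * (2 * d + 1) * \<delta> n" if "u \<in> S n" "w \<in> S n" for u w n
  proof -
    have "(1/2) *\<^sub>R u + (1/2) *\<^sub>R w \<in> D"
      using that D by (auto simp: S_def intro!: convexD)
    then have "d \<le> norm (a - ((1/2) *\<^sub>R u + (1/2) *\<^sub>R w))" by (rule dD)
    then have "d\<^sup>2 \<le> (norm (a - ((1/2) *\<^sub>R u + (1/2) *\<^sub>R w)))\<^sup>2"
      using d0 by (rule power_mono)
    moreover have "(norm (a - u))\<^sup>2 \<le> (d + \<delta> n)\<^sup>2" "(norm (a - w))\<^sup>2 \<le> (d + \<delta> n)\<^sup>2"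
      using that by (auto simp: S_def dist_norm intro!: power_mono)
    moreover have "(norm (u - w))\<^sup>2 = 2 * (norm (a - u))\<^sup>2 + 2 * (norm (a - w))\<^sup>2
        - 4 * (norm (a - ((1/2) *\<^sub>R u + (1/2) *\<^sub>R w)))\<^sup>2"
      by (simp add: power2_norm_eq_inner inner_simps inner_commute algebra_simps)
    moreover have "(d + \<delta> n)\<^sup>2 - d\<^sup>2 \<le> (2 * d + 1) * \<delta> n"
      using mult_left_mono[of "\<delta> n" 1 "\<delta> n"] \<delta>[of n] by (simp add: power2_eq_square algebra_simps)
    ultimately show ?thesis by (simp add: algebra_simps)
  qed
  obtain p where p: "\<And>n. p \<in> S n"
  proof (rule decreasing_closed_nest[of S])
    show "closed (S n)" for n using D by (auto simp: S_def)
    show "S n \<noteq> {}" for n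
    proof -
      have "(INF z\<in>D. dist a z) < d + \<delta> n"
        using D \<delta>[of n] by (simp add: d_def infdist_notempty)
      then obtain z where "z \<in> D" "dist a z < d + \<delta> n"
        using cINF_less_iff[of D "dist a"] D by (auto intro: bdd_belowI2[where m = 0])
      then show ?thesis by (auto simp: S_def)
    qed
    show "S n \<subseteq> S m" if "m \<le> n" for m n
    proof -
      have "\<delta> n \<le> \<delta> m" using that by (simp add: \<delta>_def)
      then show ?thesis by (auto simp: S_def)
    qed
    show "\<exists>n. \<forall>u\<in>S n. \<forall>w\<in>S n. dist u w < e" if "e > 0" for e
    proof -
      have "(\<lambda>n. 4 * (2 * d + 1) * \<delta> n) \<longlonglongrightarrow> 0"
        using tendsto_mult_right_zero[OF lim] .
      from order_tendstoD(2)[OF this, of "e\<^sup>2"]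
      obtain n where n: "4 * (2 * d + 1) * \<delta> n < e\<^sup>2"
        using zero_less_power[OF \<open>0 < e\<close>, of 2] unfolding eventually_sequentially by blast
      have "norm (u - w) < e" if "u \<in> S n" "w \<in> S n" for u w
        using diam[OF that] n \<open>e > 0\<close> by (intro power2_less_imp_less[of _ e]) auto
      then show ?thesis by (auto simp: dist_norm)
    qed
  qed auto
  have "norm (a - p) \<le> d + \<delta> n" for n using p[of n] by (simp add: S_def dist_norm)
  then have "norm (a - p) \<le> d"
    using LIMSEQ_le_const[OF tendsto_add[OF tendsto_const lim, of d]] by auto
  then show thesis using that[of p] p[of 0] dD order_trans unfolding S_def by blast
qed

text \<open>An obtuse angle at \<open>q\<close> makes Pythagoras an inequality, which gives minimality and uniqueness
  of \<open>q\<close> at once.\<close>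

lemma metric_projection_eqI:
  assumes "q \<in> D" and vi: "\<And>z. z \<in> D \<Longrightarrow> 0 \<le> inner (z - q) (q - a)"
  shows "metric_projection D a = q"
  unfolding metric_projection_def
proof (rule the_equality)
  have pyth: "(norm (a - q))\<^sup>2 + (norm (z - q))\<^sup>2 \<le> (norm (a - z))\<^sup>2" if "z \<in> D" for z
    using vi[OF that] by (simp add: power2_norm_eq_inner inner_simps inner_commute)
  have "norm (a - q) \<le> norm (a - z)" if "z \<in> D" for z
    using pyth[OF that] zero_le_power2[of "norm (z - q)"]
    by (intro power2_le_imp_le[of "norm (a - q)" "norm (a - z)"]) (linarith, rule norm_ge_zero)
  then show "q \<in> D \<and> (\<forall>z\<in>D. norm (a - q) \<le> norm (a - z))"
    using \<open>q \<in> D\<close> by auto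
  fix p assume p: "p \<in> D \<and> (\<forall>z\<in>D. norm (a - p) \<le> norm (a - z))"
  then have "(norm (a - p))\<^sup>2 \<le> (norm (a - q))\<^sup>2"
    using \<open>q \<in> D\<close> by (intro power_mono) auto
  then have "(norm (p - q))\<^sup>2 \<le> 0"
    using pyth[of p] p by linarith
  then show "p = q" by simp
qed

lemma metric_projection_variational:
  assumes D: "D \<noteq> {}" "closed D" "convex D"
  shows "metric_projection D a \<in> D"
    and "z \<in> D \<Longrightarrow> 0 \<le> inner (z - metric_projection D a) (metric_projection D a - a)"
proof -
  obtain p where p: "p \<in> D" "\<And>z. z \<in> D \<Longrightarrow> norm (a - p) \<le> norm (a - z)"
    using closed_convex_nearest_point[OF D] by blast
  have vi: "0 \<le> inner (z - p) (p - a)" if "z \<in> D" for z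
    using any_closest_point_dot[OF D(3,2) p(1) that, of a] p(2)
    by (simp add: dist_norm inner_simps inner_commute algebra_simps)
  have eq: "metric_projection D a = p" using p(1) vi by (rule metric_projection_eqI)
  show "metric_projection D a \<in> D" unfolding eq by (rule p(1))
  show "0 \<le> inner (z - metric_projection D a) (metric_projection D a - a)" if "z \<in> D"
    unfolding eq by (rule vi[OF that])
qed

section \<open>The resolvents of \<open>I - T\<close>\<close>

text \<open>Monotonicity of \<open>I - T\<close> is what makes resolvents comparable with fixed points, with each
  other and with arbitrary approximate fixed points.\<close>

lemma nonexpansive_monotone:
  fixes T :: "'a::real_inner \<Rightarrow> 'a"
  assumes "nonexpansive_on C T" "u \<in> C" "w \<in> C"
  shows "0 \<le> inner ((u - T u) - (w - T w)) (u - w)"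
proof -
  have "inner (T u - T w) (u - w) \<le> norm (T u - T w) * norm (u - w)" by (rule norm_cauchy_schwarz)
  also have "\<dots> \<le> norm (u - w) * norm (u - w)"
    using assms by (intro mult_right_mono) (auto simp: nonexpansive_on_def)
  also have "\<dots> = inner (u - w) (u - w)" 
    unfolding power2_norm_eq_inner[symmetric] power2_eq_square ..
  finally show ?thesis by (simp add: inner_diff_left)
qed

text \<open>The equation says that \<open>z\<close> is fixed by the strict contraction
  \<open>w \<mapsto> (c a + T w) / (1 + c)\<close> of \<open>C\<close>.\<close>

lemma resolvent_exists:
  fixes T :: "'a::{real_inner, complete_space} \<Rightarrow> 'a"
  assumes C: "closed C" "convex C" and T: "T ` C \<subseteq> C" "nonexpansive_on C T"
    and a: "a \<in> C" and c: "c > 0"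
  obtains z where "z \<in> C" "z - T z = c *\<^sub>R (a - z)"
proof -
  let ?f = "\<lambda>z. (c / (1 + c)) *\<^sub>R a + (1 / (1 + c)) *\<^sub>R T z"
  have coeff: "c / (1 + c) + 1 / (1 + c) = 1" using c by (simp add: field_simps)
  have "\<exists>!z\<in>C. ?f z = z"
  proof (rule Banach_fix)
    show "complete C" using C by (simp add: complete_eq_closed)
    show "?f ` C \<subseteq> C" using C a T c coeff by (auto intro!: convexD)
    show "dist (?f u) (?f w) \<le> (1 / (1 + c)) * dist u w" if "u \<in> C" "w \<in> C" for u w
      using T that c
      by (auto simp: dist_norm nonexpansive_on_def divide_right_mono simp flip: scaleR_diff_right)
  qed (use a c in auto)
  then obtain z where z: "z \<in> C" "?f z = z" by auto
  have "(1 + c) *\<^sub>R z = (1 + c) *\<^sub>R ?f z" using z by simp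
  also have "\<dots> = c *\<^sub>R a + T z" using c by (simp add: scaleR_add_right)
  finally have "z - T z = c *\<^sub>R (a - z)" by (simp add: algebra_simps)
  then show thesis using that z by auto
qed

text \<open>The hypothesis makes \<open>f\<close> increasing, hence Cauchy, and this passes to \<open>u\<close>.\<close>

lemma convergent_of_dominated_increments:
  fixes u :: "nat \<Rightarrow> 'a::{real_inner, complete_space}"
  assumes inc: "\<And>m n. m < n \<Longrightarrow> (norm (u n - u m))\<^sup>2 \<le> f n - f m"
    and bd: "\<And>n. f n \<le> (B::real)"
  shows "convergent u"
proof -
  have "f m \<le> f n" if "m \<le> n" for m n
    using inc[of m n] that zero_le_power2[of "norm (u n - u m)"] by (cases "m = n") (simp, linarith)
  then have "incseq f" by (auto simp: incseq_def)
  then have "Cauchy f" using bd by (metis LIMSEQ_imp_Cauchy incseq_convergent)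
  have "Cauchy u"
  proof (rule CauchyI')
    fix e :: real assume e: "0 < e"
    then obtain N where N: "\<And>m n. m \<ge> N \<Longrightarrow> n \<ge> N \<Longrightarrow> norm (f m - f n) < e\<^sup>2"
      using CauchyD[OF \<open>Cauchy f\<close>, of "e\<^sup>2"] by auto
    have "norm (u m - u n) < e" if "m \<ge> N" "n > m" for m n
      using inc[OF that(2)] N[of n m] that e
      by (intro power2_less_imp_less[of _ e]) (auto simp: norm_minus_commute)
    then show "\<exists>M. \<forall>m\<ge>M. \<forall>n>m. dist (u m) (u n) < e" by (auto simp: dist_norm)
  qed
  then show ?thesis by (rule Cauchy_convergent)
qed

text \<open>Applied to \<open>b = z' - a\<close> and \<open>d = z - a\<close>, where \<open>z'\<close> and \<open>z\<close> are the resolvents with parameters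
  \<open>s\<close> and \<open>t\<close>: the hypothesis is then monotonicity of \<open>I - T\<close>. It forces \<open>d\<close> to make an acute angle
  with \<open>b - d\<close>, so lowering the parameter increases the squared distance to \<open>a\<close> by at least the
  squared displacement.\<close>

lemma resolvent_increment:
  fixes b d :: "'a::real_inner"
  assumes mono: "0 \<le> inner (t *\<^sub>R d - s *\<^sub>R b) (b - d)" and "0 \<le> s" "s < t"
  shows "(norm (b - d))\<^sup>2 \<le> (norm b)\<^sup>2 - (norm d)\<^sup>2"
proof -
  have "s * (norm (b - d))\<^sup>2 \<le> (t - s) * inner d (b - d)"
    using mono by (simp add: power2_norm_eq_inner inner_simps inner_commute algebra_simps)
  then have "0 \<le> (t - s) * inner d (b - d)"
    using \<open>0 \<le> s\<close> by (meson mult_nonneg_nonneg order_trans zero_le_power2)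
  then have "0 \<le> inner d (b - d)" using \<open>s < t\<close> by (simp add: zero_le_mult_iff)
  then show ?thesis by (simp add: power2_norm_eq_inner inner_simps inner_commute)
qed

text \<open>The squared distances from \<open>a\<close> increase by at least the squared displacements, and monotonicity
  against a fixed point bounds them, so the resolvents converge. Their limit is fixed because the
  parameters tend to \<open>0\<close>, and the variational inequality satisfied by each resolvent survives in the
  limit and identifies it as the projection of \<open>a\<close>.\<close>

lemma resolvents_converge:
  fixes T :: "'a::{real_inner, complete_space} \<Rightarrow> 'a"
  assumes C: "closed C" "convex C" and T: "T ` C \<subseteq> C" "nonexpansive_on C T"
    and F: "fixed_points C T \<noteq> {}" and a: "a \<in> C"
  obtains z where "\<And>k. z k \<in> C"
    and "\<And>k. z k - T (z k) = inverse (real (Suc k)) *\<^sub>R (a - z k)"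
    and "z \<longlonglongrightarrow> metric_projection (fixed_points C T) a"
    and "metric_projection (fixed_points C T) a \<in> fixed_points C T"
    and "\<And>k p. p \<in> fixed_points C T \<Longrightarrow> norm (z k - a) \<le> norm (p - a)"
proof -
  define \<mu> where "\<mu> k = inverse (real (Suc k))" for k
  have \<mu>: "0 < \<mu> k" for k by (simp add: \<mu>_def)
  have \<mu>_less: "\<mu> n < \<mu> m" if "m < n" for m n using that by (simp add: \<mu>_def)
  have "\<exists>w. w \<in> C \<and> w - T w = \<mu> k *\<^sub>R (a - w)" for k
    using resolvent_exists[OF C T a \<mu>] by metis
  then obtain z where zC: "\<And>k. z k \<in> C" and z: "\<And>k. z k - T (z k) = \<mu> k *\<^sub>R (a - z k)"
    by metis
  have vi: "0 \<le> inner (p - z k) (z k - a)" if "p \<in> fixed_points C T" for p k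
  proof -
    have "0 \<le> inner (\<mu> k *\<^sub>R (a - z k)) (z k - p)"
      using nonexpansive_monotone[OF T(2) zC[of k], of p] that by (simp add: fixed_points_def z)
    then have "0 \<le> inner (a - z k) (z k - p)" using \<mu>[of k] by (simp add: zero_le_mult_iff)
    then show ?thesis by (simp add: inner_simps inner_commute)
  qed
  have bound: "norm (z k - a) \<le> norm (p - a)" if "p \<in> fixed_points C T" for p k
  proof (rule power2_le_imp_le)
    have "(norm (p - a))\<^sup>2 = (norm (z k - a))\<^sup>2 + (norm (p - z k))\<^sup>2 + 2 * inner (p - z k) (z k - a)"
      by (simp add: power2_norm_eq_inner inner_simps inner_commute)
    then show "(norm (z k - a))\<^sup>2 \<le> (norm (p - a))\<^sup>2" using vi[OF that, of k] by simp
  qed simp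
  have "(norm (z n - z m))\<^sup>2 \<le> (norm (z n - a))\<^sup>2 - (norm (z m - a))\<^sup>2" if "m < n" for m n
  proof -
    have "0 \<le> inner (\<mu> m *\<^sub>R (z m - a) - \<mu> n *\<^sub>R (z n - a)) ((z n - a) - (z m - a))"
      using nonexpansive_monotone[OF T(2) zC[of n] zC[of m]] unfolding z
      by (simp add: algebra_simps)
    then show ?thesis
      using resolvent_increment[of "\<mu> m" "z m - a" "\<mu> n" "z n - a"] \<mu>[of n] \<mu>_less[OF that] by simp
  qed
  moreover obtain p where p: "p \<in> fixed_points C T" using F by auto
  have "(norm (z n - a))\<^sup>2 \<le> (norm (p - a))\<^sup>2" for n
    using bound[OF p] by (intro power_mono) auto
  ultimately have "convergent z" by (rule convergent_of_dominated_increments)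
  then obtain q where q: "z \<longlonglongrightarrow> q" by (auto simp: convergent_def)
  have qC: "q \<in> C" using closed_sequentially[OF C(1)] zC q by blast
  have "(\<lambda>k. T (z k)) \<longlonglongrightarrow> T q"
  proof (rule LIM_zero_cancel, rule Lim_null_comparison)
    show "\<forall>\<^sub>F k in sequentially. norm (T (z k) - T q) \<le> norm (z k - q)"
      using T(2) zC qC by (simp add: nonexpansive_on_def)
    show "(\<lambda>k. norm (z k - q)) \<longlonglongrightarrow> 0" using q by (simp add: LIM_zero tendsto_norm_zero)
  qed
  then have "(\<lambda>k. z k - T (z k)) \<longlonglongrightarrow> q - T q" using q by (intro tendsto_diff)
  moreover have "(\<lambda>k. z k - T (z k)) \<longlonglongrightarrow> 0 *\<^sub>R (a - q)"
    unfolding z \<mu>_def by (intro tendsto_intros q LIMSEQ_inverse_real_of_nat)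
  ultimately have "q - T q = 0 *\<^sub>R (a - q)" by (rule LIMSEQ_unique)
  then have qF: "q \<in> fixed_points C T" using qC by (simp add: fixed_points_def)
  have "0 \<le> inner (p - q) (q - a)" if "p \<in> fixed_points C T" for p
  proof (rule LIMSEQ_le_const)
    show "(\<lambda>k. inner (p - z k) (z k - a)) \<longlonglongrightarrow> inner (p - q) (q - a)"
      by (intro tendsto_intros q)
  qed (use vi[OF that] in auto)
  with qF have "metric_projection (fixed_points C T) a = q" by (rule metric_projection_eqI)
  then show thesis using that[of z] zC z q qF bound by (simp add: \<mu>_def)
qed

section \<open>Asymptotically fixed sequences\<close>

text \<open>A sequence that stays at least as close to \<open>a\<close> as the fixed points and whose residuals vanish
  must approach the fixed point nearest to \<open>a\<close>. The whole argument is the quantitative estimate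
  below, valid for all \<open>n\<close> and \<open>k\<close>: choosing first \<open>k\<close> and then \<open>n\<close> large makes both terms small.\<close>

lemma asymptotically_fixed_converges:
  fixes T :: "'a::{real_inner, complete_space} \<Rightarrow> 'a" and x :: "nat \<Rightarrow> 'a"
  assumes C: "closed C" "convex C" and T: "T ` C \<subseteq> C" "nonexpansive_on C T"
    and F: "fixed_points C T \<noteq> {}" and a: "a \<in> C" and xC: "\<And>n. x n \<in> C"
    and bound: "\<And>n p. p \<in> fixed_points C T \<Longrightarrow> norm (x n - a) \<le> norm (p - a)"
    and resid: "(\<lambda>n. norm (x n - T (x n))) \<longlonglongrightarrow> 0"
  shows "metric_projection (fixed_points C T) a \<in> fixed_points C T"
    and "x \<longlonglongrightarrow> metric_projection (fixed_points C T) a"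
proof -
  define q where "q = metric_projection (fixed_points C T) a"
  define R where "R = norm (q - a)"
  define e where "e n = norm (x n - T (x n))" for n
  obtain z where zC: "\<And>k. z k \<in> C"
    and z: "\<And>k. z k - T (z k) = inverse (real (Suc k)) *\<^sub>R (a - z k)"
    and zq: "z \<longlonglongrightarrow> q" and qF: "q \<in> fixed_points C T" and zR: "\<And>k. norm (z k - a) \<le> R"
    using resolvents_converge[OF C T F a] unfolding q_def R_def by metis
  show "metric_projection (fixed_points C T) a \<in> fixed_points C T" using qF by (simp add: q_def)
  have xR: "norm (x n - a) \<le> R" for n using bound[OF qF] by (simp add: R_def)
  have xz: "norm (x n - z k) \<le> 2 * R" for n k
    using norm_triangle_ineq4[of "x n - a" "z k - a"] xR[of n] zR[of k] by simp
  have xq: "norm (x n - q) \<le> 2 * R" for n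
    using norm_triangle_ineq4[of "x n - a" "q - a"] xR[of n] by (simp add: R_def)
  have key: "(norm (x n - q))\<^sup>2 \<le> 6 * R * norm (z k - q) + 4 * R * real (Suc k) * e n" for n k
  proof -
    have "(norm (x n - a))\<^sup>2 \<le> (norm (q - a))\<^sup>2"
      using xR[of n] by (intro power_mono) (auto simp: R_def)
    then have "(norm (x n - q))\<^sup>2 \<le> 2 * inner (x n - q) (a - q)"
      by (simp add: power2_norm_eq_inner inner_simps inner_commute)
    also have "\<dots> = 2 * inner (a - z k) (x n - z k)
        + 2 * inner (z k - q) (a - z k) + 2 * inner (x n - q) (z k - q)"
      by (simp add: inner_simps inner_commute)
    finally have 1: "(norm (x n - q))\<^sup>2 \<le> 2 * inner (a - z k) (x n - z k)
        + 2 * inner (z k - q) (a - z k) + 2 * inner (x n - q) (z k - q)" .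
    \<comment> \<open>Monotonicity of \<open>I - T\<close> brings in the residual; clearing the denominator costs \<open>k + 1\<close>.\<close>
    have "inverse (real (Suc k)) * inner (a - z k) (x n - z k) \<le> inner (x n - T (x n)) (x n - z k)"
      using nonexpansive_monotone[OF T(2) xC[of n] zC[of k]] by (simp add: z inner_diff_left)
    also have "\<dots> \<le> e n * norm (x n - z k)" unfolding e_def by (rule norm_cauchy_schwarz)
    also have "\<dots> \<le> e n * (2 * R)" by (intro mult_left_mono xz) (simp add: e_def)
    finally have 2: "inner (a - z k) (x n - z k) \<le> real (Suc k) * (e n * (2 * R))"
      by (simp add: field_simps)
    have 3: "inner (z k - q) (a - z k) \<le> norm (z k - q) * R"
      using norm_cauchy_schwarz[of "z k - q" "a - z k"] mult_left_mono[OF zR, of "norm (z k - q)" k]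
      by (simp add: norm_minus_commute)
    have 4: "inner (x n - q) (z k - q) \<le> 2 * R * norm (z k - q)"
      using norm_cauchy_schwarz[of "x n - q" "z k - q"] mult_right_mono[OF xq, of "norm (z k - q)" n]
      by simp
    from 1 2 3 4 show ?thesis by (simp add: algebra_simps)
  qed
  have "(\<lambda>n. (norm (x n - q))\<^sup>2) \<longlonglongrightarrow> 0"
  proof (rule LIMSEQ_I)
    fix r :: real assume "0 < r"
    have "(\<lambda>k. 6 * R * norm (z k - q)) \<longlonglongrightarrow> 0"
      using zq by (intro tendsto_mult_right_zero tendsto_norm_zero LIM_zero)
    from order_tendstoD(2)[OF this, of "r / 2"] obtain k where k: "6 * R * norm (z k - q) < r / 2"
      using \<open>0 < r\<close> by (auto simp: eventually_sequentially)
    have "(\<lambda>n. 4 * R * real (Suc k) * e n) \<longlonglongrightarrow> 0"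
      unfolding e_def by (intro tendsto_mult_right_zero resid)
    from order_tendstoD(2)[OF this, of "r / 2"]
    obtain N where N: "\<And>n. n \<ge> N \<Longrightarrow> 4 * R * real (Suc k) * e n < r / 2"
      using \<open>0 < r\<close> by (auto simp: eventually_sequentially)
    have "(norm (x n - q))\<^sup>2 < r" if "n \<ge> N" for n
      using key[of n k] k N[OF that] by linarith
    then show "\<exists>N. \<forall>n\<ge>N. norm ((norm (x n - q))\<^sup>2 - 0) < r" by auto
  qed
  then have "(\<lambda>n. x n - q) \<longlonglongrightarrow> 0"
    by (simp add: tendsto_norm_zero_iff)
  then show "x \<longlonglongrightarrow> metric_projection (fixed_points C T) a"
    unfolding q_def by (rule LIM_zero_cancel)
qed

section \<open>The hybrid iteration\<close>

theorem theorem6p5: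
  fixes C :: "'a::{real_inner, complete_space} set"
    and T :: "'a \<Rightarrow> 'a"
    and \<alpha> \<beta> :: "nat \<Rightarrow> real"
    and \<alpha>_min \<alpha>_max :: real
    and x v y :: "nat \<Rightarrow> 'a"
    and Cn Cn_star Qn :: "nat \<Rightarrow> 'a set"
  assumes "C \<noteq> {}" and "closed C" and "convex C"
    and "T ` C \<subseteq> C" and "nonexpansive_on C T" and "fixed_points C T \<noteq> {}"
    and "\<And>n. \<alpha> n \<in> {0..1}" and "\<And>n. \<beta> n \<in> {0..1}"
    and "0 < \<alpha>_min" and "\<And>n. \<alpha>_min \<le> \<alpha> n" and "\<And>n. \<alpha> n \<le> \<alpha>_max" and "\<alpha>_max < 1"
    and "\<And>n. 0 < \<beta> n" and "\<And>n. \<beta> n \<le> 1"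
    and "x 0 \<in> C"
    and "\<And>n. v n = (1 - \<alpha> n) *\<^sub>R x n + \<alpha> n *\<^sub>R T (x n)"
    and "\<And>n. y n = (1 - \<beta> n) *\<^sub>R x n + \<beta> n *\<^sub>R T (v n)"
    and "\<And>n. Cn n = {z \<in> C. (norm (z - y n))\<^sup>2
            \<le> (norm (z - x n))\<^sup>2 - \<alpha> n * \<beta> n * (1 - \<alpha> n) * (norm (x n - T (x n)))\<^sup>2}"
    and "\<And>n. Qn n = {z \<in> C. inner (z - x n) (x n - x 0) \<ge> 0}"
    and "\<And>n. closed (Cn_star n)" and "\<And>n. convex (Cn_star n)"
    and "\<And>n. fixed_points C T \<subseteq> Cn_star n" and "\<And>n. Cn_star n \<subseteq> Cn n"
    and "\<And>n. x (Suc n) = metric_projection (Cn_star n \<inter> Qn n) (x 0)"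
  shows "metric_projection (fixed_points C T) (x 0) \<in> fixed_points C T
    \<and> x \<longlonglongrightarrow> metric_projection (fixed_points C T) (x 0)"
  proof -
  note C = \<open>closed C\<close> \<open>convex C\<close> and T = \<open>T ` C \<subseteq> C\<close> \<open>nonexpansive_on C T\<close>
  note Q = assms(19) and star = assms(20-23) and step = assms(24)
  define F where "F = fixed_points C T"
  define a where "a = x 0"
  obtain p where p: "p \<in> F" using assms(6) by (auto simp: F_def)
  have FC: "F \<subseteq> C" by (auto simp: F_def fixed_points_def)
  \<comment> \<open>\<open>Cn_star n\<close> lies in \<open>C\<close>, so only the half-space matters in the intersection.\<close>
  have QP: "Cn_star n \<inter> Qn n = Cn_star n \<inter> {z. 0 \<le> inner (z - x n) (x n - a)}" for n
    using star(4)[of n] assms(18)[of n] by (auto simp: Q a_def)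
  have "closed (Cn_star n \<inter> Qn n)" for n
    unfolding QP using star(1)
    by (intro closed_Int) (auto intro!: closed_Collect_le continuous_intros)
  moreover have "convex (Cn_star n \<inter> Qn n)" for n
  proof -
    have "{z. 0 \<le> inner (z - x n) (x n - a)} = {z. inner (x n - a) z \<ge> inner (x n - a) (x n)}"
      by (auto simp: inner_diff_left inner_commute)
    then show ?thesis unfolding QP using star(2) by (auto intro!: convex_Int convex_halfspace_ge)
  qed
  ultimately have proj: "x (Suc n) \<in> Cn_star n \<inter> Qn n"
      "\<And>z. z \<in> Cn_star n \<inter> Qn n \<Longrightarrow> 0 \<le> inner (z - x (Suc n)) (x (Suc n) - a)"
    if "Cn_star n \<inter> Qn n \<noteq> {}" for n
    using metric_projection_variational[OF that] unfolding step a_def by blast+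
  \<comment> \<open>The base case holds because \<open>Qn 0 = C\<close>. In the step, the induction hypothesis makes the set
    projected onto nonempty, and the inequality for that projection is membership in \<open>Qn (Suc n)\<close>.\<close>
  have FQ: "F \<subseteq> Cn_star n \<inter> Qn n" for n
  proof (induction n)
    case 0
    show ?case using star(3)[of 0] FC by (auto simp: F_def Q)
  next
    case (Suc n)
    then have "0 \<le> inner (z - x (Suc n)) (x (Suc n) - a)" if "z \<in> F" for z
      using proj(2)[of n z] that by auto
    then show ?case using star(3)[of "Suc n"] FC by (auto simp: F_def Q a_def)
  qed
  have ne: "Cn_star n \<inter> Qn n \<noteq> {}" for n using FQ p by blast
  have xC: "x n \<in> C" for n
    using assms(15) proj(1)[OF ne] by (cases n) (auto simp: Q)
  have TC: "T u \<in> C" if "u \<in> C" for u using T(1) that by auto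
  have vC: "v n \<in> C" for n
    unfolding assms(16) using C xC TC assms(7)[of n] by (auto intro!: convexD)
  have bound: "norm (x n - a) \<le> norm (z - a)" if "z \<in> F" for n z
  proof (rule power2_le_imp_le)
    have "0 \<le> inner (z - x n) (x n - a)" using FQ[of n] that by (auto simp: Q a_def)
    then show "(norm (x n - a))\<^sup>2 \<le> (norm (z - a))\<^sup>2"
      using zero_le_power2[of "norm (z - x n)"]
      unfolding power2_norm_eq_inner by (simp add: inner_simps inner_commute)
  qed simp
  have incr: "(norm (x (Suc n) - x n))\<^sup>2 \<le> (norm (x (Suc n) - a))\<^sup>2 - (norm (x n - a))\<^sup>2" for n
  proof -
    have "0 \<le> inner (x (Suc n) - x n) (x n - a)" using proj(1)[OF ne[of n]] by (auto simp: Q a_def)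
    then show ?thesis by (simp add: power2_norm_eq_inner inner_simps inner_commute)
  qed
  have "(\<lambda>n. norm (x (Suc n) - x n)) \<longlonglongrightarrow> 0"
  proof -
    let ?f = "\<lambda>n. (norm (x n - a))\<^sup>2"
    have "incseq ?f"
    proof (rule incseq_SucI)
      show "?f n \<le> ?f (Suc n)" for n
        using incr[of n] zero_le_power2[of "norm (x (Suc n) - x n)"] by linarith
    qed
    moreover have "?f n \<le> (norm (p - a))\<^sup>2" for n
      using bound[OF p] by (intro power_mono) auto
    ultimately obtain L where L: "?f \<longlonglongrightarrow> L"
      using incseq_convergent[of ?f] by blast
    have "(\<lambda>n. ?f (Suc n) - ?f n) \<longlonglongrightarrow> L - L" by (intro tendsto_diff LIMSEQ_Suc L)
    then have "(\<lambda>n. ?f (Suc n) - ?f n) \<longlonglongrightarrow> 0" by simp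
    then have "(\<lambda>n. (norm (x (Suc n) - x n))\<^sup>2) \<longlonglongrightarrow> 0"
      by (rule Lim_null_comparison[rotated]) (use incr in auto)
    then show ?thesis by simp
  qed
  \<comment> \<open>The factor \<open>8\<close> is \<open>4\<close> from \<open>norm (x n - T (v n)) \<le> 4 * norm (p - a)\<close> times \<open>2\<close> from
    \<open>b + c \<le> 2 * b\<close>.\<close>
  define M where "M = 8 * norm (p - a)"
  have resid: "\<alpha>_min * (1 - \<alpha>_max) * (norm (x n - T (x n)))\<^sup>2 \<le> M * norm (x (Suc n) - x n)" for n
  proof -
    have Tp: "T p = p" "p \<in> C" using p by (auto simp: F_def fixed_points_def)
    have ne_p: "norm (T u - p) \<le> norm (u - p)" if "u \<in> C" for u
      using T(2) that Tp unfolding nonexpansive_on_def by metis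
    have xp: "norm (x n - p) \<le> 2 * norm (p - a)"
      using norm_triangle_ineq4[of "x n - a" "p - a"] bound[OF p, of n] by simp
    have "v n - p = (1 - \<alpha> n) *\<^sub>R (x n - p) + \<alpha> n *\<^sub>R (T (x n) - p)"
      by (simp add: assms(16) algebra_simps)
    also have "norm \<dots> \<le> (1 - \<alpha> n) * norm (x n - p) + \<alpha> n * norm (T (x n) - p)"
      using assms(7)[of n] by (intro norm_triangle_le) simp
    also have "\<dots> \<le> (1 - \<alpha> n) * norm (x n - p) + \<alpha> n * norm (x n - p)"
      using assms(7)[of n] ne_p[OF xC] by (intro add_left_mono mult_left_mono) auto
    finally have "norm (v n - p) \<le> norm (x n - p)" by (simp add: algebra_simps)
    then have "norm (T (v n) - p) \<le> norm (x n - p)" using ne_p[OF vC] order_trans by blast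
    then have xTv: "norm (x n - T (v n)) \<le> 4 * norm (p - a)"
      using norm_triangle_ineq4[of "x n - p" "T (v n) - p"] xp by simp
    have xy: "norm (y n - x n) = \<beta> n * norm (x n - T (v n))"
    proof -
      have "y n - x n = - \<beta> n *\<^sub>R (x n - T (v n))" by (simp add: assms(17) algebra_simps)
      then show ?thesis using assms(13)[of n] by simp
    qed
    \<comment> \<open>The cut gives a bound by \<open>b\<^sup>2 - c\<^sup>2\<close>. Estimating this by \<open>b\<^sup>2\<close> would leave a useless factor
      \<open>1 / \<beta> n\<close>; factoring it as \<open>(b - c) * (b + c)\<close> with \<open>b - c \<le> norm (y n - x n)\<close> keeps a
      factor \<open>\<beta> n\<close> on the right.\<close>
    define b where "b = norm (x (Suc n) - x n)"
    define c where "c = norm (x (Suc n) - y n)"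
    have "x (Suc n) \<in> Cn n" using proj(1)[OF ne[of n]] star(4)[of n] by auto
    then have cut: "\<alpha> n * \<beta> n * (1 - \<alpha> n) * (norm (x n - T (x n)))\<^sup>2 \<le> b\<^sup>2 - c\<^sup>2"
      by (simp add: assms(18) b_def c_def)
    moreover have "0 \<le> \<alpha> n * \<beta> n * (1 - \<alpha> n) * (norm (x n - T (x n)))\<^sup>2"
      using assms(7,8)[of n] by simp
    ultimately have "c\<^sup>2 \<le> b\<^sup>2" by linarith
    then have cb: "c \<le> b" by (rule power2_le_imp_le) (simp add: b_def)
    have "b - c \<le> norm (y n - x n)"
      using norm_triangle_ineq2[of "x (Suc n) - x n" "x (Suc n) - y n"] by (simp add: b_def c_def)
    moreover have "b\<^sup>2 - c\<^sup>2 = (b - c) * (b + c)" by (simp add: power2_eq_square algebra_simps)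
    ultimately have "b\<^sup>2 - c\<^sup>2 \<le> norm (y n - x n) * (2 * b)"
      using cb by (simp only:) (intro mult_mono, auto simp: b_def c_def)
    also have "\<dots> \<le> \<beta> n * (4 * norm (p - a)) * (2 * b)"
      unfolding xy using xTv assms(13)[of n]
      by (intro mult_right_mono mult_left_mono) (auto simp: b_def)
    finally have "\<beta> n * (\<alpha> n * (1 - \<alpha> n) * (norm (x n - T (x n)))\<^sup>2) \<le> \<beta> n * (M * b)"
      using cut by (simp add: M_def algebra_simps)
    then have "\<alpha> n * (1 - \<alpha> n) * (norm (x n - T (x n)))\<^sup>2 \<le> M * b"
      using assms(13)[of n] by simp
    moreover have "\<alpha>_min * (1 - \<alpha>_max) * (norm (x n - T (x n)))\<^sup>2
        \<le> \<alpha> n * (1 - \<alpha> n) * (norm (x n - T (x n)))\<^sup>2"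
      using assms(7)[of n] assms(9) assms(10)[of n] assms(11)[of n] assms(12)
      by (intro mult_right_mono mult_mono) auto
    ultimately show ?thesis by (simp add: b_def)
  qed
  have "(\<lambda>n. norm (x n - T (x n))) \<longlonglongrightarrow> 0"
  proof -
    define c where "c = \<alpha>_min * (1 - \<alpha>_max)"
    have "0 < c" using assms(9,12) by (simp add: c_def)
    have "(\<lambda>n. (M / c) * norm (x (Suc n) - x n)) \<longlonglongrightarrow> 0"
      by (intro tendsto_mult_right_zero \<open>(\<lambda>n. norm (x (Suc n) - x n)) \<longlonglongrightarrow> 0\<close>)
    moreover have "(norm (x n - T (x n)))\<^sup>2 \<le> (M / c) * norm (x (Suc n) - x n)" for n
      using resid[of n] \<open>0 < c\<close> by (simp add: c_def[symmetric] field_simps)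
    ultimately have "(\<lambda>n. (norm (x n - T (x n)))\<^sup>2) \<longlonglongrightarrow> 0"
      by (rule_tac Lim_null_comparison) auto
    then show ?thesis by simp
  qed
  with bound show ?thesis
    using asymptotically_fixed_converges[where x = x, OF C T assms(6) assms(15) xC]
    unfolding F_def a_def by simp
qed

end
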